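(* Let $\mathbb{F}$ be a field, let $\lambda_1,\dots,\lambda_q\in\mathbb{F}$ be distinct, let $m_1,\dots,m_q$ be positive integers with $m_1+\cdots+m_q=d$, and let $\Lambda=\{\lambda_1^{(m_1)},\dots,\lambda_q^{(m_q)}\}$. For any polynomial $p(x)\in\mathbb{F}[x]$ of degree at most $d-1$, $$\hat H_\Lambda^{-1}[p(x)]=T_\Lambda^{-1}\operatorname{eval}_\Lambda(p(x)),$$ and this vector records the coefficients of $p(x)$ as a linear combination of $\hat{\mathcal{H}}_\Lambda=\{\hat h_{1,0}(x),\dots,\hat h_{q,m_q-1}(x)\}$, which gives the partial fraction decomposition of $p(x)/\prod_{i=1}^q(x-\lambda_i)^{m_i}$. That is, if the entries of this vector are denoted $b_{j,m}$ ($1\le j\le q$, $0\le m\le m_j-1$), in the order $(1,0),\dots,(1,m_1-1),\dots,(q,0),\dots,(q,m_q-1)$, then $$p(x)=\sum_{j=1}^q\sum_{m=0}^{m_j-1}b_{j,m}\hat h_{j,m}(x)\quad\text{and}\quad \frac{p(x)}{\prod_{i=1}^q(x-\lambda_i)^{m_i}}=\sum_{j=1}^q\frac{\sum_{m=0}^{m_j-1}b_{j,m}(x-\lambda_j)^m}{(x-\lambda_j)^{m_j}}.$$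
   Context: Hasse derivative: for a polynomial $p(x)=\sum_i c_i x^i\in\mathbb{F}[x]$ and an integer $r\ge 0$, $\mathcal{D}^{(r)}p(x)=\sum_{i\ge r} c_i\binom{i}{r}x^{i-r}$, where $\binom{i}{r}$ is interpreted as its image in $\mathbb{F}$; $\mathcal{D}^{(r)}p(\lambda)$ denotes its value at $x=\lambda$. Notation: $\Lambda=\{\lambda_1^{(m_1)},\dots,\lambda_q^{(m_q)}\}$ is the multiset in which the distinct element $\lambda_i$ has multiplicity $m_i$. Coefficient vector: for a polynomial $p(x)=c_0+c_1x+\cdots+c_{d-1}x^{d-1}$ of degree at most $d-1$, $[p(x)]=[c_0,\dots,c_{d-1}]^\top\in\mathbb{F}^d$. Evaluation vector: $\operatorname{eval}_\Lambda(p(x))\in\mathbb{F}^d$ is the column vector with entries, in order, $\mathcal{D}^{(0)}p(\lambda_1),\dots,\mathcal{D}^{(m_1-1)}p(\lambda_1),\ \dots,\ \mathcal{D}^{(0)}p(\lambda_q),\dots,\mathcal{D}^{(m_q-1)}p(\lambda_q)$. Confluent Vandermonde matrix: for $\lambda\in\mathbb{F}$ and $m\le d$, $V_{\lambda^{(m)}}^{(d)}$ is the $m\times d$ matrix whose entry in row $r$ and column $i$ ($0\le r\le m-1$, $0\le i\le d-1$) is $\binom{i}{r}\lambda^{i-r}$ if $i\ge r$ and $0$ if $i<r$ (with $\lambda^0=1$). The $d\times d$ matrix $V_\Lambda$ is obtained by stacking $V_{\lambda_1^{(m_1)}}^{(d)},\dots,V_{\lambda_q^{(m_q)}}^{(d)}$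 vertically in this order. The polynomials $\hat h_{j,m}$: for $j=1,\dots,q$ and $m=0,\dots,m_j-1$, $$\hat h_{j,m}(x)=(x-\lambda_j)^m\prod_{1\le k\le q,\ k\ne j}(x-\lambda_k)^{m_k}.$$ These are $d$ polynomials of degree at most $d-1$, listed in the order $\hat h_{1,0},\dots,\hat h_{1,m_1-1},\dots,\hat h_{q,0},\dots,\hat h_{q,m_q-1}$. Matrices: $\hat H_\Lambda$ is the $d\times d$ matrix whose columns are, from left to right, the coefficient vectors $[\hat h_{1,0}(x)],\dots,[\hat h_{1,m_1-1}(x)],\dots,[\hat h_{q,0}(x)],\dots,[\hat h_{q,m_q-1}(x)]$, and $T_\Lambda=V_\Lambda\hat H_\Lambda$. Both $\hat H_\Lambda$ and $T_\Lambda$ are invertible, so the inverses in the claim make sense. *)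

theory Defs
  imports
    "Jordan_Normal_Form.Gauss_Jordan_Elimination"
    "HOL-Computational_Algebra.Polynomial"
    "HOL-Computational_Algebra.Fraction_Field"
begin

text \<open>
  The multiset \<open>\<Lambda> = {\<lambda>\<^sub>1^(m\<^sub>1), \<dots>, \<lambda>\<^sub>q^(m\<^sub>q)}\<close> is given by \<open>q\<close> and two functions \<open>lam\<close> and
  \<open>ms\<close>, of which only the values at the indices \<open>1, \<dots>, q\<close> matter.  Rows and columns of matrices
  and entries of vectors are numbered from \<open>0\<close>.
\<close>

definition hasse_deriv :: "nat \<Rightarrow> 'a::comm_semiring_1 poly \<Rightarrow> 'a poly" where
  "hasse_deriv r p = (\<Sum>i=r..degree p. monom (coeff p i * of_nat (i choose r)) (i - r))"

definition coeff_vec :: "nat \<Rightarrow> 'a::zero poly \<Rightarrow> 'a vec" where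
  "coeff_vec d p = vec d (coeff p)"

text \<open>
  The pairs \<open>(1,0), \<dots>, (1,m\<^sub>1-1), \<dots>, (q,0), \<dots>, (q,m\<^sub>q-1)\<close> in this order, and the entry of a vector
  at the position of \<open>(j,r)\<close> in that order.
\<close>

definition index_pairs :: "nat \<Rightarrow> (nat \<Rightarrow> nat) \<Rightarrow> (nat \<times> nat) list" where
  "index_pairs q ms = concat (map (\<lambda>j. map (\<lambda>r. (j, r)) [0..<ms j]) [1..<Suc q])"

definition pair_entry :: "(nat \<Rightarrow> nat) \<Rightarrow> 'a vec \<Rightarrow> nat \<Rightarrow> nat \<Rightarrow> 'a" where
  "pair_entry ms v j r = v $ ((\<Sum>k=1..<j. ms k) + r)"

definition eval_vec :: "nat \<Rightarrow> (nat \<Rightarrow> 'a) \<Rightarrow> (nat \<Rightarrow> nat) \<Rightarrow> 'a::comm_semiring_1 poly \<Rightarrow> 'a vec" where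
  "eval_vec q lam ms p =
     vec_of_list (map (\<lambda>(j, r). poly (hasse_deriv r p) (lam j)) (index_pairs q ms))"

definition confluent_block :: "nat \<Rightarrow> 'a::comm_semiring_1 \<Rightarrow> nat \<Rightarrow> 'a mat" where
  "confluent_block d x m =
     mat m d (\<lambda>(r, i). if r \<le> i then of_nat (i choose r) * x ^ (i - r) else 0)"

definition confluent_vandermonde ::
    "nat \<Rightarrow> nat \<Rightarrow> (nat \<Rightarrow> 'a::comm_semiring_1) \<Rightarrow> (nat \<Rightarrow> nat) \<Rightarrow> 'a mat" where
  "confluent_vandermonde d q lam ms =
     mat_of_rows d (concat (map (\<lambda>j. rows (confluent_block d (lam j) (ms j))) [1..<Suc q]))"

definition h_hat ::
    "nat \<Rightarrow> (nat \<Rightarrow> 'a::comm_ring_1) \<Rightarrow> (nat \<Rightarrow> nat) \<Rightarrow> nat \<Rightarrow> nat \<Rightarrow> 'a poly" where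
  "h_hat q lam ms j r =
     [:- lam j, 1:] ^ r * (\<Prod>k\<in>{1..q} - {j}. [:- lam k, 1:] ^ ms k)"

definition H_hat :: "nat \<Rightarrow> nat \<Rightarrow> (nat \<Rightarrow> 'a::comm_ring_1) \<Rightarrow> (nat \<Rightarrow> nat) \<Rightarrow> 'a mat" where
  "H_hat d q lam ms =
     mat_of_cols d (map (\<lambda>(j, r). coeff_vec d (h_hat q lam ms j r)) (index_pairs q ms))"

definition T_mat :: "nat \<Rightarrow> nat \<Rightarrow> (nat \<Rightarrow> 'a::comm_ring_1) \<Rightarrow> (nat \<Rightarrow> nat) \<Rightarrow> 'a mat" where
  "T_mat d q lam ms = confluent_vandermonde d q lam ms * H_hat d q lam ms"

text \<open>
  \<open>mat_inverse\<close> is option-valued; \<open>mat_inv A\<close> is the inverse of \<open>A\<close> only if \<open>A\<close> is invertible.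
\<close>

definition mat_inv :: "'a::field mat \<Rightarrow> 'a mat" where
  "mat_inv A = the (mat_inverse A)"

end

theory Submission
  imports Defs "Jordan_Normal_Form.Determinant"
begin

text \<open>
  Let \<open>d\<close> be the sum of the multiplicities.  As linear maps, \<open>H_hat\<close> sends a vector \<open>b\<close> to the
  coefficient vector of the polynomial \<open>\<Sum> b\<^sub>j\<^sub>m h\<^sub>j\<^sub>m\<close>, and the confluent Vandermonde matrix sends
  the coefficient vector of a polynomial of degree below \<open>d\<close> to its vector of Hasse derivatives.
  Hence \<open>T_mat\<close> sends \<open>b\<close> to the Hasse derivatives of \<open>\<Sum> b\<^sub>j\<^sub>m h\<^sub>j\<^sub>m\<close>, and the vector \<open>b\<close> with
  \<open>p = \<Sum> b\<^sub>j\<^sub>m h\<^sub>j\<^sub>m\<close> solves both \<open>H_hat b = [p]\<close> and \<open>T_mat b = eval p\<close>.  Once both matrices are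
  known to be invertible, everything except the partial fractions follows, and these result from
  dividing \<open>p = \<Sum> b\<^sub>j\<^sub>m h\<^sub>j\<^sub>m\<close> by the full product.

  Invertibility is shown by a trivial kernel, and both kernels are computed from one fact
  (\<open>linear_power_dvd_iff_taylor\<close>): \<open>(x - c)^n\<close> divides a polynomial iff its first \<open>n\<close> Taylor
  coefficients at \<open>c\<close>, which are its Hasse derivatives at \<open>c\<close>, vanish.

  \<^item> If the Hasse derivatives of a polynomial of degree below \<open>d\<close> vanish at every node up to its
    multiplicity, the polynomial is divisible by a product of degree \<open>d\<close>, so it is zero
    (\<open>eq_zero_if_hasse_deriv_zero\<close>).

  \<^item> If \<open>\<Sum> b\<^sub>j\<^sub>m h\<^sub>j\<^sub>m = 0\<close>, fix \<open>j\<close>.  The terms belonging to other nodes are divisible by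
    \<open>(x - \<lambda>\<^sub>j)^m\<^sub>j\<close>, hence so is the part belonging to \<open>j\<close>.  That part is \<open>\<Sum>\<^sub>m b\<^sub>j\<^sub>m (x - \<lambda>\<^sub>j)^m\<close> times a
    polynomial not vanishing at \<open>\<lambda>\<^sub>j\<close>, so the first factor is divisible by \<open>(x - \<lambda>\<^sub>j)^m\<^sub>j\<close>, and its
    Taylor coefficients \<open>b\<^sub>j\<^sub>m\<close> vanish (\<open>h_hat_independent\<close>).

  No division by factorials occurs, so the characteristic of the field is arbitrary.
\<close>

section \<open>Taylor shifts and Hasse derivatives\<close>

lemma pcompose_power_linear:
  fixes p :: "'a::comm_ring_1 poly"
  shows "pcompose (p ^ n) q = pcompose p q ^ n"
  by (induction n) (simp_all add: pcompose_mult pcompose_1)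

lemma coeff_linear_power:
  fixes c :: "'a::comm_ring_1"
  shows "coeff ([:c, 1:] ^ i) r = (if r \<le> i then of_nat (i choose r) * c ^ (i - r) else 0)"
  by (auto simp: coeff_linear_poly_power degree_linear_power intro!: coeff_eq_0)

text \<open>
  The summation bound is any \<open>d\<close> above the degree, and the weights are written exactly as the entries
  of a confluent Vandermonde block, so that the right-hand side is a row of that block applied to the
  coefficient vector of \<open>p\<close>.
\<close>

lemma coeff_taylor_shift:
  fixes p :: "'a::comm_ring_1 poly"
  assumes "degree p < d"
  shows "coeff (pcompose p [:c, 1:]) r
    = (\<Sum>i<d. coeff p i * (if r \<le> i then of_nat (i choose r) * c ^ (i - r) else 0))"
proof -
  have "p = (\<Sum>i\<le>d-1. monom (coeff p i) i)"
    using assms by (intro poly_as_sum_of_monoms'[symmetric]) simp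
  also have "{..d-1} = {..<d}"
    using assms by auto
  finally have "pcompose p [:c, 1:] = pcompose (\<Sum>i<d. smult (coeff p i) ([:0, 1:] ^ i)) [:c, 1:]"
    by (simp add: monom_altdef)
  also have "\<dots> = (\<Sum>i<d. smult (coeff p i) ([:c, 1:] ^ i))"
    by (simp add: pcompose_sum pcompose_smult pcompose_power_linear pcompose_pCons)
  finally show ?thesis
    by (simp add: coeff_sum coeff_linear_power)
qed

text \<open>
  Hasse derivatives are Taylor coefficients: expanding \<open>(x + c)^i\<close> binomially, \<open>x^i\<close> contributes
  \<open>(i choose r) c^(i-r)\<close> to the coefficient of \<open>x^r\<close>.
\<close>

lemma poly_hasse_deriv:
  fixes p :: "'a::comm_ring_1 poly"
  shows "poly (hasse_deriv r p) c = coeff (pcompose p [:c, 1:]) r"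
proof -
  have "poly (hasse_deriv r p) c
      = (\<Sum>i=r..degree p. coeff p i * (of_nat (i choose r) * c ^ (i - r)))"
    by (simp add: hasse_deriv_def poly_sum poly_monom mult.assoc)
  also have "\<dots> = (\<Sum>i<Suc (degree p).
      coeff p i * (if r \<le> i then of_nat (i choose r) * c ^ (i - r) else 0))"
    by (intro sum.mono_neutral_cong_left) auto
  also have "\<dots> = coeff (pcompose p [:c, 1:]) r"
    by (rule coeff_taylor_shift[symmetric]) simp
  finally show ?thesis .
qed

text \<open>
  The substitution of \<open>x + c\<close> for \<open>x\<close> is an automorphism of the polynomial ring that carries \<open>x - c\<close>
  to \<open>x\<close>, and divisibility by \<open>x^n\<close> can be read off from the coefficients.
\<close>

lemma linear_power_dvd_iff_taylor:
  fixes p :: "'a::field poly"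
  shows "[:- c, 1:] ^ n dvd p \<longleftrightarrow> (\<forall>r<n. coeff (pcompose p [:c, 1:]) r = 0)"
proof -
  have to: "pcompose ([:- c, 1:] ^ n) [:c, 1:] = monom 1 n"
    by (simp add: pcompose_power_linear pcompose_pCons monom_altdef)
  have fro: "pcompose (monom 1 n) [:- c, 1:] = [:- c, 1:] ^ n"
    by (simp add: pcompose_power_linear pcompose_pCons monom_altdef)
  have p: "pcompose (pcompose p [:c, 1:]) [:- c, 1:] = p"
    by (simp add: pcompose_assoc[symmetric] pcompose_pCons)
  have "[:- c, 1:] ^ n dvd p \<longleftrightarrow> monom 1 n dvd pcompose p [:c, 1:]"
  proof
    assume "[:- c, 1:] ^ n dvd p"
    then show "monom 1 n dvd pcompose p [:c, 1:]"
      by (metis dvd_def pcompose_mult to)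
  next
    assume "monom 1 n dvd pcompose p [:c, 1:]"
    then show "[:- c, 1:] ^ n dvd p"
      by (metis dvd_def pcompose_mult fro p)
  qed
  then show ?thesis
    by (simp add: monom_1_dvd_iff')
qed

section \<open>Products of powers of distinct linear factors\<close>

text \<open>
  Here and below, coprimality of \<open>(x - c)^n\<close> and \<open>g\<close> is expressed as \<open>g(c) \<noteq> 0\<close>; the cancellation
  then follows by comparing the orders of the zero \<open>c\<close>.
\<close>

lemma linear_power_dvd_cancel:
  fixes f g :: "'a::field poly"
  assumes "[:- c, 1:] ^ n dvd g * f" and "poly g c \<noteq> 0"
  shows "[:- c, 1:] ^ n dvd f"
proof (cases "f = 0")
  case False
  moreover have "g \<noteq> 0"
    using assms(2) by auto
  ultimately show ?thesis
    using assms by (auto simp: order_divides order_mult order_0I)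
qed simp

lemma poly_prod_linear_powers_nonzero:
  fixes lam :: "nat \<Rightarrow> 'a::field"
  assumes "inj_on lam (insert j A)" and "j \<notin> A" and "finite A"
  shows "poly (\<Prod>k\<in>A. [:- lam k, 1:] ^ ms k) (lam j) \<noteq> 0"
  using assms by (auto simp: poly_prod inj_on_def)

lemma prod_linear_powers_dvd:
  fixes lam :: "nat \<Rightarrow> 'a::field"
  assumes "finite A" and "inj_on lam A" and "\<And>k. k \<in> A \<Longrightarrow> [:- lam k, 1:] ^ ms k dvd f"
  shows "(\<Prod>k\<in>A. [:- lam k, 1:] ^ ms k) dvd f"
  using assms
proof (induction A rule: finite_induct)
  case (insert j A)
  let ?P = "\<Prod>k\<in>A. [:- lam k, 1:] ^ ms k"
  have "?P dvd f"
    using insert by (intro insert.IH) (auto simp: inj_on_def)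
  then obtain g where g: "f = ?P * g" ..
  have "poly ?P (lam j) \<noteq> 0"
    using insert.prems(1) insert.hyps by (intro poly_prod_linear_powers_nonzero)
  then have "[:- lam j, 1:] ^ ms j dvd g"
    by (rule linear_power_dvd_cancel[rotated]) (use insert.prems(2)[of j] in \<open>simp add: g\<close>)
  then have "[:- lam j, 1:] ^ ms j * ?P dvd g * ?P"
    by (rule mult_dvd_mono) simp
  then show ?case
    unfolding g prod.insert[OF insert.hyps] by (simp only: mult.commute[of g])
qed simp

lemma degree_prod_linear_powers:
  fixes lam :: "nat \<Rightarrow> 'a::field"
  shows "degree (\<Prod>k\<in>A. [:- lam k, 1:] ^ ms k) = (\<Sum>k\<in>A. ms k)"
  by (cases "finite A") (simp_all add: degree_prod_eq_sum_degree degree_linear_power)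

lemma degree_h_hat:
  fixes lam :: "nat \<Rightarrow> 'a::field"
  assumes "j \<in> {1..q}" and "r < ms j"
  shows "degree (h_hat q lam ms j r) < (\<Sum>k=1..q. ms k)"
proof -
  have "degree (h_hat q lam ms j r) \<le> r + (\<Sum>k\<in>{1..q} - {j}. ms k)"
    unfolding h_hat_def
    by (rule order.trans[OF degree_mult_le])
       (simp add: degree_linear_power degree_prod_linear_powers)
  also have "\<dots> < (\<Sum>k=1..q. ms k)"
    using assms by (simp add: sum.remove[of "{1..q}" j] del: One_nat_def)
  finally show ?thesis .
qed

lemma eq_zero_if_hasse_deriv_zero:
  fixes lam :: "nat \<Rightarrow> 'a::field"
  assumes "inj_on lam {1..q}" and "degree p < (\<Sum>k=1..q. ms k)"
    and "\<And>j r. j \<in> {1..q} \<Longrightarrow> r < ms j \<Longrightarrow> poly (hasse_deriv r p) (lam j) = 0"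
  shows "p = 0"
proof (rule ccontr)
  assume "p \<noteq> 0"
  have "(\<Prod>k\<in>{1..q}. [:- lam k, 1:] ^ ms k) dvd p"
    using assms by (intro prod_linear_powers_dvd)
      (auto simp: linear_power_dvd_iff_taylor poly_hasse_deriv)
  from dvd_imp_degree_le[OF this \<open>p \<noteq> 0\<close>] show False
    using assms(2) by (simp add: degree_prod_linear_powers)
qed

text \<open>
  All \<open>h\<^sub>j\<^sub>m\<close> with the same \<open>j\<close> share the cofactor of \<open>(x - \<lambda>\<^sub>j)^m\<^sub>j\<close>.  This drives both the
  independence argument and the passage to partial fractions.
\<close>

lemma h_hat_combination_factor:
  fixes lam :: "nat \<Rightarrow> 'a::comm_ring_1"
  shows "(\<Sum>m\<in>A. smult (b m) (h_hat q lam ms j m))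
    = (\<Prod>k\<in>{1..q} - {j}. [:- lam k, 1:] ^ ms k) * (\<Sum>m\<in>A. smult (b m) ([:- lam j, 1:] ^ m))"
proof -
  have "G * smult c X = smult c (X * G)" for c and G X :: "'a poly"
    by (simp add: mult.commute)
  then show ?thesis
    unfolding h_hat_def sum_distrib_left by (simp only:)
qed

text \<open>
  This is the uniqueness of partial fractions: reducing the vanishing combination modulo
  \<open>(x - \<lambda>\<^sub>j)^m\<^sub>j\<close> isolates the terms at \<open>\<lambda>\<^sub>j\<close>, and their coefficients are Taylor coefficients at \<open>\<lambda>\<^sub>j\<close>.
\<close>

lemma h_hat_independent:
  fixes lam :: "nat \<Rightarrow> 'a::field"
  assumes inj: "inj_on lam {1..q}"
    and zero: "(\<Sum>j=1..q. \<Sum>m<ms j. smult (b j m) (h_hat q lam ms j m)) = 0"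
    and j: "j \<in> {1..q}" and r: "r < ms j"
  shows "b j r = 0"
proof -
  let ?X = "[:- lam j, 1:] ^ ms j"
  let ?g = "\<Prod>k\<in>{1..q} - {j}. [:- lam k, 1:] ^ ms k"
  let ?B = "\<Sum>m<ms j. smult (b j m) ([:- lam j, 1:] ^ m)"
  let ?S = "\<lambda>i. \<Sum>m<ms i. smult (b i m) (h_hat q lam ms i m)"
  have other: "?X dvd ?S i" if "i \<in> {1..q} - {j}" for i
  proof -
    have "?X dvd (\<Prod>k\<in>{1..q} - {i}. [:- lam k, 1:] ^ ms k)"
      using that j by (intro dvd_prodI) auto
    then show ?thesis
      unfolding h_hat_combination_factor by (rule dvd_mult2)
  qed
  \<comment> \<open>Solving for the terms at \<open>\<lambda>\<^sub>j\<close> transfers the divisibility of all other terms to them.\<close>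
  have "?S j + (\<Sum>i\<in>{1..q} - {j}. ?S i) = 0"
    using zero j by (simp add: sum.remove[of "{1..q}" j] del: One_nat_def)
  then have "?S j = - (\<Sum>i\<in>{1..q} - {j}. ?S i)"
    by (simp add: eq_neg_iff_add_eq_0)
  moreover have "?X dvd - (\<Sum>i\<in>{1..q} - {j}. ?S i)"
    by (subst dvd_minus_iff) (rule dvd_sum[OF other])
  ultimately have "?X dvd ?S j"
    by (rule ssubst)
  then have "?X dvd ?g * ?B"
    by (rule h_hat_combination_factor[THEN subst])
  moreover have "poly ?g (lam j) \<noteq> 0"
    using inj j by (intro poly_prod_linear_powers_nonzero) (auto simp: insert_absorb)
  ultimately have "?X dvd ?B"
    by (rule linear_power_dvd_cancel)
  then have "coeff (pcompose ?B [:lam j, 1:]) r = 0"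
    using r by (simp only: linear_power_dvd_iff_taylor)
  \<comment> \<open>The Taylor coefficients of \<open>?B\<close> at \<open>\<lambda>\<^sub>j\<close> are the scalars \<open>b j m\<close> themselves.\<close>
  moreover have "pcompose ?B [:lam j, 1:] = (\<Sum>m<ms j. monom (b j m) m)"
    by (simp add: pcompose_sum pcompose_smult pcompose_power_linear pcompose_pCons monom_altdef)
  ultimately show ?thesis
    using r by (simp add: coeff_sum)
qed

section \<open>The ordering of the index pairs\<close>

definition position :: "(nat \<Rightarrow> nat) \<Rightarrow> nat \<times> nat \<Rightarrow> nat" where
  "position ms = (\<lambda>(j, r). (\<Sum>k=1..<j. ms k) + r)"

lemma pair_entry_position: "pair_entry ms v j r = v $ position ms (j, r)"
  by (simp add: pair_entry_def position_def)

text \<open>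
  Numbering the listed pairs by \<open>position\<close> yields \<open>0, 1, 2, \<dots>\<close>.  This one equation contains the
  length of the list, the absence of repetitions, and the fact that \<open>position\<close> inverts list access.
\<close>

lemma map_position_index_pairs:
  "map (position ms) (index_pairs q ms) = [0..<\<Sum>k=1..q. ms k]"
proof (induction q)
  case (Suc q)
  have "map (position ms) (map (Pair (Suc q)) [0..<ms (Suc q)])
      = map (\<lambda>r. r + (\<Sum>k=1..q. ms k)) [0..<ms (Suc q)]"
    by (simp add: position_def atLeastLessThanSuc_atLeastAtMost)
  also have "\<dots> = [(\<Sum>k=1..q. ms k)..<(\<Sum>k=1..q. ms k) + ms (Suc q)]"
    by (simp add: map_add_upt add.commute)
  finally show ?case
    using Suc by (simp add: index_pairs_def upt_add_eq_append[symmetric])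
qed (simp add: index_pairs_def)

lemma length_index_pairs: "length (index_pairs q ms) = (\<Sum>k=1..q. ms k)"
  using arg_cong[OF map_position_index_pairs, of length] by simp

lemma position_nth_index_pairs:
  assumes "i < (\<Sum>k=1..q. ms k)"
  shows "position ms (index_pairs q ms ! i) = i"
  using arg_cong[OF map_position_index_pairs[of ms q], of "\<lambda>xs. xs ! i"] assms
  by (simp add: length_index_pairs)

lemma set_index_pairs: "set (index_pairs q ms) = (SIGMA j:{1..q}. {..<ms j})"
  by (force simp: index_pairs_def simp del: upt_Suc)

text \<open>
  Matrix-vector products sum over flat indices, the claim over pairs.  The summand may depend on both
  the flat index and the pair, since it combines a vector entry with a polynomial.
\<close>

lemma sum_index_pairs:
  "(\<Sum>i<(\<Sum>k=1..q. ms k). f i (index_pairs q ms ! i))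
    = (\<Sum>j=1..q. \<Sum>m<ms j. f (position ms (j, m)) (j, m))"
proof -
  let ?L = "index_pairs q ms"
  have "distinct ?L"
    using map_position_index_pairs[of ms q] by (metis distinct_map distinct_upt)
  then have "bij_betw ((!) ?L) {..<\<Sum>k=1..q. ms k} (set ?L)"
    by (simp add: bij_betw_nth length_index_pairs)
  then have "(\<Sum>x\<in>set ?L. f (position ms x) x)
      = (\<Sum>i<(\<Sum>k=1..q. ms k). f (position ms (?L ! i)) (?L ! i))"
    by (rule sum.reindex_bij_betw[symmetric])
  also have "\<dots> = (\<Sum>i<(\<Sum>k=1..q. ms k). f i (?L ! i))"
    by (simp add: position_nth_index_pairs)
  finally show ?thesis
    by (simp add: set_index_pairs sum.Sigma)
qed

lemma vec_eq_zero_if_pair_entries_zero: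
  assumes "v \<in> carrier_vec (\<Sum>k=1..q. ms k)"
    and "\<And>j r. j \<in> {1..q} \<Longrightarrow> r < ms j \<Longrightarrow> pair_entry ms v j r = 0"
  shows "v = 0\<^sub>v (\<Sum>k=1..q. ms k)"
proof (rule eq_vecI)
  fix i assume "i < dim_vec (0\<^sub>v (\<Sum>k=1..q. ms k))"
  then have i: "i < (\<Sum>k=1..q. ms k)"
    by simp
  obtain j r where jr: "index_pairs q ms ! i = (j, r)"
    by fastforce
  then have "(j, r) \<in> set (index_pairs q ms)"
    using i by (metis length_index_pairs nth_mem)
  then have "pair_entry ms v j r = 0"
    by (intro assms(2)) (auto simp: set_index_pairs)
  then show "v $ i = 0\<^sub>v (\<Sum>k=1..q. ms k) $ i"
    using i position_nth_index_pairs[OF i] by (simp add: pair_entry_position jr)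
qed (use assms in simp)

section \<open>The matrices as linear maps\<close>

lemma H_hat_carrier:
  "d = (\<Sum>k=1..q. ms k) \<Longrightarrow> H_hat d q lam ms \<in> carrier_mat d d"
  by (auto simp: H_hat_def mat_of_cols_def length_index_pairs)

lemma H_hat_mult_vec:
  assumes d: "d = (\<Sum>k=1..q. ms k)" and v: "v \<in> carrier_vec d"
  shows "H_hat d q lam ms *\<^sub>v v
    = coeff_vec d (\<Sum>j=1..q. \<Sum>m<ms j. smult (pair_entry ms v j m) (h_hat q lam ms j m))"
proof (rule eq_vecI)
  fix i assume "i < dim_vec (coeff_vec d
    (\<Sum>j=1..q. \<Sum>m<ms j. smult (pair_entry ms v j m) (h_hat q lam ms j m)))"
  then have i: "i < d"
    by (simp add: coeff_vec_def)
  have "(H_hat d q lam ms *\<^sub>v v) $ i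
      = (\<Sum>k<(\<Sum>k=1..q. ms k).
          (\<lambda>k (j, r). coeff (h_hat q lam ms j r) i * v $ k) k (index_pairs q ms ! k))"
    using i v d by (auto simp: H_hat_def mat_of_cols_def length_index_pairs scalar_prod_def
        coeff_vec_def split_def lessThan_atLeast0 intro!: sum.cong)
  also have "\<dots> = (\<Sum>j=1..q. \<Sum>m<ms j. coeff (h_hat q lam ms j m) i * pair_entry ms v j m)"
    by (subst sum_index_pairs) (simp add: pair_entry_position)
  finally show "(H_hat d q lam ms *\<^sub>v v) $ i = coeff_vec d
      (\<Sum>j=1..q. \<Sum>m<ms j. smult (pair_entry ms v j m) (h_hat q lam ms j m)) $ i"
    using i by (simp add: coeff_vec_def coeff_sum mult.commute)
qed (simp add: H_hat_def coeff_vec_def)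

text \<open>
  Rewriting the stacked blocks as one list over the index pairs gives the rows the same numbering as
  the entries of the evaluation vector.
\<close>

lemma confluent_vandermonde_eq:
  "confluent_vandermonde d q lam ms = mat_of_rows d
     (map (\<lambda>(j, r). row (confluent_block d (lam j) (ms j)) r) (index_pairs q ms))"
  by (simp add: confluent_vandermonde_def index_pairs_def map_concat rows_def
      confluent_block_def comp_def del: upt_Suc)

lemma confluent_vandermonde_carrier:
  "d = (\<Sum>k=1..q. ms k) \<Longrightarrow> confluent_vandermonde d q lam ms \<in> carrier_mat d d"
  by (auto simp: confluent_vandermonde_eq mat_of_rows_def length_index_pairs)

lemma confluent_vandermonde_mult_coeff_vec:
  fixes p :: "'a::comm_ring_1 poly"
  assumes d: "d = (\<Sum>k=1..q. ms k)" and p: "degree p < d"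
  shows "confluent_vandermonde d q lam ms *\<^sub>v coeff_vec d p = eval_vec q lam ms p"
proof (rule eq_vecI)
  fix i assume "i < dim_vec (eval_vec q lam ms p)"
  then have i: "i < length (index_pairs q ms)"
    by (simp add: eval_vec_def)
  obtain j r where jr: "index_pairs q ms ! i = (j, r)"
    by fastforce
  then have "(j, r) \<in> set (index_pairs q ms)"
    using i by (metis nth_mem)
  then have r: "r < ms j"
    by (auto simp: set_index_pairs)
  have "(confluent_vandermonde d q lam ms *\<^sub>v coeff_vec d p) $ i
      = (\<Sum>k<d. (if r \<le> k then of_nat (k choose r) * lam j ^ (k - r) else 0) * coeff p k)"
    using i r jr by (auto simp: confluent_vandermonde_eq mat_of_rows_def scalar_prod_def
        coeff_vec_def confluent_block_def lessThan_atLeast0 intro!: sum.cong)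
  also have "\<dots> = poly (hasse_deriv r p) (lam j)"
    unfolding poly_hasse_deriv coeff_taylor_shift[OF p] by (simp add: mult.commute)
  also have "\<dots> = eval_vec q lam ms p $ i"
    using i jr by (simp add: eval_vec_def vec_of_list_index)
  finally show "(confluent_vandermonde d q lam ms *\<^sub>v coeff_vec d p) $ i
      = eval_vec q lam ms p $ i" .
qed (simp add: confluent_vandermonde_eq eval_vec_def)

lemma coeff_vec_eq_iff:
  assumes "degree f < d" and "degree g < d"
  shows "coeff_vec d f = coeff_vec d g \<longleftrightarrow> f = g"
proof
  assume eq: "coeff_vec d f = coeff_vec d g"
  show "f = g"
  proof (rule poly_eqI)
    fix i
    show "coeff f i = coeff g i"
    proof (cases "i < d")
      case True
      then show ?thesis
        using arg_cong[OF eq, of "\<lambda>v. v $ i"] by (simp add: coeff_vec_def)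
    next
      case False
      then show ?thesis
        using assms by (simp add: coeff_eq_0)
    qed
  qed
qed simp

lemma mat_inv_if_trivial_kernel:
  fixes A :: "'a::field mat"
  assumes A: "A \<in> carrier_mat n n"
    and ker: "\<And>v. v \<in> carrier_vec n \<Longrightarrow> A *\<^sub>v v = 0\<^sub>v n \<Longrightarrow> v = 0\<^sub>v n"
  shows "invertible_mat A" and "mat_inv A \<in> carrier_mat n n"
    and "A * mat_inv A = 1\<^sub>m n" and "mat_inv A * A = 1\<^sub>m n"
proof -
  have "det A \<noteq> 0"
    using det_0_iff_vec_prod_zero_field[OF A] ker by blast
  then have "A \<in> Units (ring_mat TYPE('a) n ())"
    by (rule det_non_zero_imp_unit[OF A])
  then obtain B where "mat_inverse A = Some B"
    using mat_inverse(1)[OF A] by fastforce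
  with mat_inverse(2)[OF A this]
  show inv: "mat_inv A \<in> carrier_mat n n" "A * mat_inv A = 1\<^sub>m n" "mat_inv A * A = 1\<^sub>m n"
    by (simp_all add: mat_inv_def)
  then show "invertible_mat A"
    using A by (auto simp: invertible_mat_def inverts_mat_def square_mat.simps)
qed

section \<open>Sums of fractions\<close>

lemma sum_Fract_same_denominator:
  assumes "P \<noteq> 0"
  shows "(\<Sum>j\<in>A. Fract (f j) P) = Fract (\<Sum>j\<in>A. f j) P"
proof (induction A rule: infinite_finite_induct)
  case (insert j A)
  then show ?case
    using assms by (simp add: eq_fract algebra_simps)
qed (use assms in \<open>simp_all add: Zero_fract_def eq_fract\<close>)

lemma partial_fractions_if_h_hat_combination:
  fixes lam :: "nat \<Rightarrow> 'a::field"
  assumes "p = (\<Sum>j=1..q. \<Sum>m<ms j. smult (b j m) (h_hat q lam ms j m))"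
  shows "Fract p (\<Prod>i=1..q. [:- lam i, 1:] ^ ms i)
    = (\<Sum>j=1..q. Fract (\<Sum>m<ms j. smult (b j m) ([:- lam j, 1:] ^ m)) ([:- lam j, 1:] ^ ms j))"
proof -
  let ?P = "\<Prod>i=1..q. [:- lam i, 1:] ^ ms i"
  let ?g = "\<lambda>j. \<Prod>k\<in>{1..q} - {j}. [:- lam k, 1:] ^ ms k"
  have "Fract p ?P = (\<Sum>j=1..q. Fract (\<Sum>m<ms j. smult (b j m) (h_hat q lam ms j m)) ?P)"
    unfolding assms by (rule sum_Fract_same_denominator[symmetric]) simp
  also have "\<dots> = (\<Sum>j=1..q. Fract (\<Sum>m<ms j. smult (b j m) ([:- lam j, 1:] ^ m))
                                ([:- lam j, 1:] ^ ms j))"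
  proof (rule sum.cong)
    fix j assume "j \<in> {1..q}"
    \<comment> \<open>Cancelling the cofactor of \<open>(x - \<lambda>\<^sub>j)^m\<^sub>j\<close> reduces the denominator to the \<open>j\<close>-th power alone.\<close>
    then have P: "?P = ?g j * [:- lam j, 1:] ^ ms j"
      by (simp add: prod.remove[of "{1..q}" j] mult.commute del: One_nat_def)
    have nz: "?g j \<noteq> 0"
      by simp
    show "Fract (\<Sum>m<ms j. smult (b j m) (h_hat q lam ms j m)) ?P
        = Fract (\<Sum>m<ms j. smult (b j m) ([:- lam j, 1:] ^ m)) ([:- lam j, 1:] ^ ms j)"
      unfolding P h_hat_combination_factor by (rule mult_fract_cancel[OF nz])
  qed simp
  finally show ?thesis .
qed

section \<open>Change of basis\<close>

theorem theorem5p4: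
  fixes lam :: "nat \<Rightarrow> 'a::field"
    and ms :: "nat \<Rightarrow> nat"
    and q d :: nat
    and p :: "'a poly"
  assumes "inj_on lam {1..q}"
    and "\<And>j. j \<in> {1..q} \<Longrightarrow> 0 < ms j"
    and "(\<Sum>j=1..q. ms j) = d"
    and "degree p < d"
  shows "invertible_mat (H_hat d q lam ms)
    \<and> invertible_mat (T_mat d q lam ms)
    \<and> mat_inv (H_hat d q lam ms) *\<^sub>v coeff_vec d p
        = mat_inv (T_mat d q lam ms) *\<^sub>v eval_vec q lam ms p
    \<and> (let b = pair_entry ms (mat_inv (H_hat d q lam ms) *\<^sub>v coeff_vec d p) in
        p = (\<Sum>j=1..q. \<Sum>m<ms j. smult (b j m) (h_hat q lam ms j m))
        \<and> Fract p (\<Prod>i=1..q. [:- lam i, 1:] ^ ms i)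
          = (\<Sum>j=1..q. Fract (\<Sum>m<ms j. smult (b j m) ([:- lam j, 1:] ^ m))
                              ([:- lam j, 1:] ^ ms j)))"
proof -
  let ?H = "H_hat d q lam ms" and ?T = "T_mat d q lam ms"
  define comb where
    "comb v = (\<Sum>j=1..q. \<Sum>m<ms j. smult (pair_entry ms v j m) (h_hat q lam ms j m))" for v :: "'a vec"
  note d = assms(3)[symmetric]
  note H = H_hat_carrier[OF d, of lam] and V = confluent_vandermonde_carrier[OF d, of lam]
  have T: "?T \<in> carrier_mat d d"
    using H V by (simp add: T_mat_def)
  have deg: "degree (comb v) < d" for v
    using assms(4) degree_h_hat[of _ q _ ms lam] unfolding comb_def d
    by (intro degree_sum_less) (auto intro!: degree_sum_less le_less_trans[OF degree_smult_le])
  have H_mult: "?H *\<^sub>v v = coeff_vec d (comb v)" if "v \<in> carrier_vec d" for v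
    unfolding comb_def by (rule H_hat_mult_vec[OF d that])
  have T_mult: "?T *\<^sub>v v = eval_vec q lam ms (comb v)" if "v \<in> carrier_vec d" for v
    using that H V H_mult confluent_vandermonde_mult_coeff_vec[OF d deg]
    by (simp add: T_mat_def)
  have comb_inj: "v = 0\<^sub>v d" if "v \<in> carrier_vec d" "comb v = 0" for v
    using that h_hat_independent[OF assms(1), of "pair_entry ms v" ms]
    unfolding comb_def d by (intro vec_eq_zero_if_pair_entries_zero) auto
  have ker_H: "v = 0\<^sub>v d" if v: "v \<in> carrier_vec d" and z: "?H *\<^sub>v v = 0\<^sub>v d" for v
  proof (rule comb_inj[OF v])
    have "coeff_vec d (comb v) = coeff_vec d 0"
      using H_mult[OF v, symmetric] z by (simp add: coeff_vec_def zero_vec_def coeff_0[abs_def])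
    then show "comb v = 0"
      using coeff_vec_eq_iff[OF deg, of 0] assms(4) by auto
  qed
  have ker_T: "v = 0\<^sub>v d" if v: "v \<in> carrier_vec d" and z: "?T *\<^sub>v v = 0\<^sub>v d" for v
  proof (rule comb_inj[OF v])
    have "poly (hasse_deriv r (comb v)) (lam j) = 0" if "j \<in> {1..q}" "r < ms j" for j r
    proof -
      have "(j, r) \<in> set (index_pairs q ms)"
        using that by (simp add: set_index_pairs)
      then obtain i where i: "i < length (index_pairs q ms)" "index_pairs q ms ! i = (j, r)"
        by (auto simp: in_set_conv_nth)
      then have "poly (hasse_deriv r (comb v)) (lam j) = eval_vec q lam ms (comb v) $ i"
        by (simp add: eval_vec_def vec_of_list_index)
      also have "\<dots> = 0"
        using T_mult[OF v] z i by (simp add: length_index_pairs d)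
      finally show ?thesis .
    qed
    then show "comb v = 0"
      using deg unfolding d by (intro eq_zero_if_hasse_deriv_zero[OF assms(1)])
  qed
  note inv_H = mat_inv_if_trivial_kernel[OF H ker_H]
    and inv_T = mat_inv_if_trivial_kernel[OF T ker_T]
  define b where "b = mat_inv ?H *\<^sub>v coeff_vec d p"
  have c: "coeff_vec d p \<in> carrier_vec d"
    by (simp add: coeff_vec_def)
  have b: "b \<in> carrier_vec d"
    using inv_H(2) by (simp add: b_def coeff_vec_def)
  have "?H *\<^sub>v b = coeff_vec d p"
    using assoc_mult_mat_vec[OF H inv_H(2) c] c by (simp add: b_def inv_H(3))
  then have p: "p = comb b"
    using H_mult[OF b] coeff_vec_eq_iff[OF deg assms(4)] by simp
  have "?T *\<^sub>v b = eval_vec q lam ms p"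
    using T_mult[OF b] p by simp
  then have "b = mat_inv ?T *\<^sub>v eval_vec q lam ms p"
    using assoc_mult_mat_vec[OF inv_T(2) T b] b by (simp add: inv_T(4))
  then show ?thesis
    unfolding Let_def b_def[symmetric]
    using inv_H(1) inv_T(1) p[unfolded comb_def]
      partial_fractions_if_h_hat_combination[OF p[unfolded comb_def]]
    by (intro conjI)
qed

end
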